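(* Let $\mathbf{A}$ be a normal and quasicomplemented distributive nearlattice. Then every prime $\alpha$-ideal of $A$ is a maximal ideal.
   Context: A distributive nearlattice is a join-semilattice $\langle A,\vee,1\rangle$ with greatest element $1$ in which every principal filter $[a)=\{x\in A\colon a\le x\}$ is a bounded distributive lattice. An ideal of $A$ is a subset $I$ that is downward closed and closed under $\vee$. A prime ideal is a non-empty proper ideal $P$ such that $a\wedge b\in P$ implies $a\in P$ or $b\in P$ whenever $a\wedge b$ exists. A maximal ideal is a non-empty proper ideal $I$ such that for every ideal $J\supseteq I$, $J=I$ or $J=A$. For $a\in A$, $a^{\top}=\{x\in A\colon x\vee a=1\}$ and $a^{\top\top}=\{y\in A\colon y\vee x=1\text{ for all }x\in a^{\top}\}$. An ideal $I$ is an $\alpha$-ideal if for each $a\in A$, $I\cap a^{\top\top}\ne\emptyset$ implies $a\in I$. $\mathbf{A}$ is normal if each prime ideal is contained in a unique maximal ideal. $\mathbf{A}$ is quasicomplemented if for each $a\in A$ there exists $b\in A$ with $a^{\top\top}=b^{\top}$. *)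

theory Defs
  imports "HOL-Algebra.Lattice"
begin

locale bounded_distributive_lattice = bounded_lattice L for L (structure) +
  assumes meet_join_distrib:
    "\<lbrakk>x \<in> carrier L; y \<in> carrier L; z \<in> carrier L\<rbrakk>
      \<Longrightarrow> x \<sqinter> (y \<squnion> z) = (x \<sqinter> y) \<squnion> (x \<sqinter> z)"

definition principal_filter :: "('a, 'b) gorder_scheme \<Rightarrow> 'a \<Rightarrow> 'a set" where
  "principal_filter L a = {x \<in> carrier L. a \<sqsubseteq>\<^bsub>L\<^esub> x}"

locale distributive_nearlattice =
  upper_semilattice L + weak_partial_order_top L for L (structure) +
  assumes principal_filter_lattice:
    "a \<in> carrier L \<Longrightarrow> bounded_distributive_lattice (L\<lparr>carrier := principal_filter L a\<rparr>)"

text \<open>The empty set counts as an ideal; non-emptiness is required only of prime and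
  maximal ideals.\<close>

definition nl_ideal :: "('a, 'b) gorder_scheme \<Rightarrow> 'a set \<Rightarrow> bool" where
  "nl_ideal L I \<longleftrightarrow> I \<subseteq> carrier L \<and>
    (\<forall>x\<in>carrier L. \<forall>y\<in>I. x \<sqsubseteq>\<^bsub>L\<^esub> y \<longrightarrow> x \<in> I) \<and>
    (\<forall>x\<in>I. \<forall>y\<in>I. x \<squnion>\<^bsub>L\<^esub> y \<in> I)"

text \<open>\<^const>\<open>meet\<close> is defined by choice, so its value is meaningful only when the greatest lower
  bound exists; hence the explicit existence hypothesis below.\<close>

definition nl_prime_ideal :: "('a, 'b) gorder_scheme \<Rightarrow> 'a set \<Rightarrow> bool" where
  "nl_prime_ideal L P \<longleftrightarrow> nl_ideal L P \<and> P \<noteq> {} \<and> P \<noteq> carrier L \<and>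
    (\<forall>a\<in>carrier L. \<forall>b\<in>carrier L.
      (\<exists>m. is_glb L m {a, b}) \<longrightarrow> a \<sqinter>\<^bsub>L\<^esub> b \<in> P \<longrightarrow> a \<in> P \<or> b \<in> P)"

definition nl_maximal_ideal :: "('a, 'b) gorder_scheme \<Rightarrow> 'a set \<Rightarrow> bool" where
  "nl_maximal_ideal L I \<longleftrightarrow> nl_ideal L I \<and> I \<noteq> {} \<and> I \<noteq> carrier L \<and>
    (\<forall>J. nl_ideal L J \<longrightarrow> I \<subseteq> J \<longrightarrow> J = I \<or> J = carrier L)"

definition annihilator :: "('a, 'b) gorder_scheme \<Rightarrow> 'a \<Rightarrow> 'a set" where
  "annihilator L a = {x \<in> carrier L. x \<squnion>\<^bsub>L\<^esub> a = \<top>\<^bsub>L\<^esub>}"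

definition double_annihilator :: "('a, 'b) gorder_scheme \<Rightarrow> 'a \<Rightarrow> 'a set" where
  "double_annihilator L a = {y \<in> carrier L. \<forall>x\<in>annihilator L a. y \<squnion>\<^bsub>L\<^esub> x = \<top>\<^bsub>L\<^esub>}"

definition alpha_ideal :: "('a, 'b) gorder_scheme \<Rightarrow> 'a set \<Rightarrow> bool" where
  "alpha_ideal L I \<longleftrightarrow> nl_ideal L I \<and>
    (\<forall>a\<in>carrier L. I \<inter> double_annihilator L a \<noteq> {} \<longrightarrow> a \<in> I)"

definition normal_nearlattice :: "('a, 'b) gorder_scheme \<Rightarrow> bool" where
  "normal_nearlattice L \<longleftrightarrow> distributive_nearlattice L \<and>
    (\<forall>P. nl_prime_ideal L P \<longrightarrow> (\<exists>!M. nl_maximal_ideal L M \<and> P \<subseteq> M))"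

definition quasicomplemented_nearlattice :: "('a, 'b) gorder_scheme \<Rightarrow> bool" where
  "quasicomplemented_nearlattice L \<longleftrightarrow> distributive_nearlattice L \<and>
    (\<forall>a\<in>carrier L. \<exists>b\<in>carrier L. double_annihilator L a = annihilator L b)"

end

theory Submission
  imports Defs
begin

text \<open>Let \<open>P\<close> be a prime \<open>\<alpha>\<close>-ideal, \<open>a \<notin> P\<close>, and \<open>b\<close> a quasicomplement of \<open>a\<close>. Since
  \<open>a \<in> a\<^sup>\<top>\<^sup>\<top> = b\<^sup>\<top>\<close>, we have \<open>a \<squnion> b = \<top>\<close>, so it suffices to show \<open>b \<in> P\<close>: then every ideal that
  contains \<open>P\<close> and \<open>a\<close> contains \<open>\<top>\<close>. Pick \<open>p \<in> P\<close> and put \<open>m = (a \<squnion> p) \<sqinter> (b \<squnion> p)\<close>. If \<open>x \<squnion> m = \<top>\<close>,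
  then \<open>x \<squnion> p\<close> lies in \<open>a\<^sup>\<top> \<inter> b\<^sup>\<top> = a\<^sup>\<top> \<inter> a\<^sup>\<top>\<^sup>\<top> = {\<top>}\<close>. Hence \<open>p \<in> m\<^sup>\<top>\<^sup>\<top>\<close>, so \<open>m \<in> P\<close> because \<open>P\<close> is an
  \<open>\<alpha>\<close>-ideal, and primality yields \<open>b \<in> P\<close>.\<close>

context distributive_nearlattice
begin

lemma top_unique: "x \<in> carrier L \<Longrightarrow> \<top> \<sqsubseteq> x \<Longrightarrow> x = \<top>"
  by (simp add: le_antisym top_closed top_higher)

text \<open>Any upper bound of \<open>x\<close> and \<open>y\<close> lies above their join, here
  \<open>\<top>\<close>.\<close>

lemma join_top_mono:
  assumes "x \<in> carrier L" "y \<in> carrier L" "z \<in> carrier L" "w \<in> carrier L"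
    and "x \<squnion> y = \<top>" "x \<sqsubseteq> z \<squnion> w" "y \<sqsubseteq> z \<squnion> w"
  shows "z \<squnion> w = \<top>"
  using assms by (metis join_closed join_le top_unique)

text \<open>A lower bound \<open>z\<close> of \<open>{x, y}\<close> need not lie in \<open>[p)\<close>, but the lower bound \<open>z \<squnion> p\<close> does.\<close>

lemma glb_exists_if_bounded_below:
  assumes p: "p \<in> carrier L" and x: "x \<in> carrier L" "p \<sqsubseteq> x" and y: "y \<in> carrier L" "p \<sqsubseteq> y"
  shows "\<exists>m. is_glb L m {x, y}"
proof -
  let ?F = "L\<lparr>carrier := principal_filter L p\<rparr>"
  interpret F: bounded_distributive_lattice ?F
    using p by (rule principal_filter_lattice)
  have "x \<in> carrier ?F" "y \<in> carrier ?F"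
    using x y by (auto simp: principal_filter_def)
  then obtain m where m: "is_glb ?F m {x, y}"
    using F.inf_of_two_exists by blast
  have mF: "m \<in> carrier L" "p \<sqsubseteq> m" "m \<sqsubseteq> x" "m \<sqsubseteq> y"
    using m by (auto simp: greatest_def Lower_def principal_filter_def x y)
  have "z \<sqsubseteq> m" if z: "z \<in> carrier L" "z \<sqsubseteq> x" "z \<sqsubseteq> y" for z
  proof -
    have "z \<squnion> p \<in> Lower ?F {x, y}"
      using z p x y by (auto simp: Lower_def principal_filter_def join_le join_right)
    then have "z \<squnion> p \<sqsubseteq> m"
      using m by (auto simp: greatest_def)
    then show ?thesis
      using z p mF by (meson join_closed join_left le_trans)
  qed
  then have "is_glb L m {x, y}"
    using mF x y by (auto simp: greatest_def Lower_def)
  then show ?thesis ..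
qed

lemma is_glb_meet: "\<exists>m. is_glb L m {x, y} \<Longrightarrow> is_glb L (x \<sqinter> y) {x, y}"
  unfolding meet_def inf_def by (rule someI_ex)

lemma mem_double_annihilator: "a \<in> carrier L \<Longrightarrow> a \<in> double_annihilator L a"
  unfolding double_annihilator_def annihilator_def by (auto simp: join_comm)

lemma annihilator_Int_double_annihilator:
  assumes "y \<in> annihilator L a" "y \<in> double_annihilator L a"
  shows "y = \<top>"
proof -
  \<comment> \<open>Being in \<open>annihilator L a\<close>, \<open>y\<close> is among the elements
    that membership in the double annihilator tests \<open>y\<close> against.\<close>
  have "y \<in> carrier L" "y \<squnion> y = \<top>"
    using assms by (auto simp: annihilator_def double_annihilator_def)
  then show ?thesis
    by (metis join_le le_refl top_unique)
qed

lemma prime_alpha_ideal_quasicomplement: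
  assumes prime: "nl_prime_ideal L P" and alpha: "alpha_ideal L P"
    and a: "a \<in> carrier L" and b: "b \<in> carrier L"
    and ab: "double_annihilator L a = annihilator L b"
  shows "a \<in> P \<or> b \<in> P"
proof -
  from prime obtain p where pP: "p \<in> P"
    by (auto simp: nl_prime_ideal_def)
  have ideal: "P \<subseteq> carrier L" "\<And>x y. x \<in> carrier L \<Longrightarrow> y \<in> P \<Longrightarrow> x \<sqsubseteq> y \<Longrightarrow> x \<in> P"
    using prime by (auto simp: nl_prime_ideal_def nl_ideal_def)
  have p: "p \<in> carrier L"
    using pP ideal by blast
  have ap: "a \<squnion> p \<in> carrier L" "p \<sqsubseteq> a \<squnion> p" and bp: "b \<squnion> p \<in> carrier L" "p \<sqsubseteq> b \<squnion> p"
    using a b p by (auto simp: join_right)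
  define m where "m = (a \<squnion> p) \<sqinter> (b \<squnion> p)"
  have ex: "\<exists>m. is_glb L m {a \<squnion> p, b \<squnion> p}"
    using glb_exists_if_bounded_below[OF p ap bp] .
  then have "is_glb L m {a \<squnion> p, b \<squnion> p}"
    unfolding m_def by (rule is_glb_meet)
  then have m: "m \<in> carrier L" "m \<sqsubseteq> a \<squnion> p" "m \<sqsubseteq> b \<squnion> p"
    using ap bp by (auto simp: greatest_def Lower_def)
  have "p \<squnion> x = \<top>" if "x \<in> annihilator L m" for x
  proof -
    have x: "x \<in> carrier L" "x \<squnion> m = \<top>"
      using that by (auto simp: annihilator_def)
    \<comment> \<open>Kept general in \<open>c\<close> to serve both \<open>a\<close> and
      \<open>b\<close>: \<open>x\<close> and \<open>m\<close> both lie below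
      \<open>p \<squnion> x \<squnion> c\<close>.\<close>
    have join_top: "(p \<squnion> x) \<squnion> c = \<top>" if c: "c \<in> carrier L" and mc: "m \<sqsubseteq> c \<squnion> p" for c
    proof (rule join_top_mono[of x m])
      have px: "p \<squnion> x \<in> carrier L" and pxc: "p \<squnion> x \<squnion> c \<in> carrier L"
        using p x c by auto
      have le: "p \<squnion> x \<sqsubseteq> p \<squnion> x \<squnion> c" "c \<sqsubseteq> p \<squnion> x \<squnion> c"
        using px c by (auto simp: join_left join_right)
      show "x \<sqsubseteq> p \<squnion> x \<squnion> c"
        using le(1) px pxc x p by (meson join_right le_trans)
      have "p \<sqsubseteq> p \<squnion> x \<squnion> c"
        using le(1) px pxc x p by (meson join_left le_trans)
      then have "c \<squnion> p \<sqsubseteq> p \<squnion> x \<squnion> c"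
        using le(2) c p pxc by (simp add: join_le)
      then show "m \<sqsubseteq> p \<squnion> x \<squnion> c"
        using mc m c p pxc by (meson join_closed le_trans)
    qed (use x m p c in auto)
    have "p \<squnion> x \<in> annihilator L a" "p \<squnion> x \<in> annihilator L b"
      using join_top a b m p x by (auto simp: annihilator_def)
    then show ?thesis
      using ab annihilator_Int_double_annihilator by blast
  qed
  then have "p \<in> double_annihilator L m"
    using p by (simp add: double_annihilator_def)
  then have "m \<in> P"
    using alpha pP m by (auto simp: alpha_ideal_def)
  \<comment> \<open>Primality applies because \<open>ex\<close> guarantees that the meet
    \<open>m\<close> exists.\<close>
  then have "a \<squnion> p \<in> P \<or> b \<squnion> p \<in> P"
    using prime ex ap bp unfolding nl_prime_ideal_def m_def by blast
  then show ?thesis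
    using ideal a b p by (meson join_left)
qed

lemma ideal_with_top:
  assumes "nl_ideal L J" "\<top> \<in> J"
  shows "J = carrier L"
  using assms top_higher unfolding nl_ideal_def by blast

end

theorem theorem3p9:
  fixes L :: "('a, 'b) gorder_scheme" and P :: "'a set"
  assumes "distributive_nearlattice L"
    and "normal_nearlattice L"
    and "quasicomplemented_nearlattice L"
    and "nl_prime_ideal L P"
    and "alpha_ideal L P"
  shows "nl_maximal_ideal L P"
proof -
  interpret distributive_nearlattice L by fact
  have "J = carrier L" if J: "nl_ideal L J" "P \<subseteq> J" "J \<noteq> P" for J
  proof -
    obtain a where a: "a \<in> J" "a \<notin> P"
      using J by blast
    then have aL: "a \<in> carrier L"
      using J by (auto simp: nl_ideal_def)
    then obtain b where b: "b \<in> carrier L" "double_annihilator L a = annihilator L b"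
      using assms(3) by (auto simp: quasicomplemented_nearlattice_def)
    \<comment> \<open>As \<open>a \<notin> P\<close>, the quasicomplement \<open>b\<close> falls
      into \<open>P \<subseteq> J\<close>.\<close>
    then have "b \<in> J"
      using prime_alpha_ideal_quasicomplement[OF assms(4,5) aL] a J by blast
    moreover have "a \<squnion>\<^bsub>L\<^esub> b = \<top>\<^bsub>L\<^esub>"
      using mem_double_annihilator[OF aL] b by (simp add: annihilator_def)
    ultimately have "\<top>\<^bsub>L\<^esub> \<in> J"
      using a J by (metis nl_ideal_def)
    then show ?thesis
      using J ideal_with_top by blast
  qed
  then show ?thesis
    using assms(4) by (auto simp: nl_maximal_ideal_def nl_prime_ideal_def)
qed

end
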